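(* Let $P$ be a principal with initial trust assumptions $\mathsf T_P^0$, local-axiom schema instances $\mathsf{LAS}_P$, and set $\mathsf{TS}$ of says-statements, and let $\ell\in\widehat\Lambda$. If $P\text{ trusts }\langle D,O,\mathsf{sattestor}(\ell)\rangle$ is derivable by repeatedly applying modus ponens and $\land$-introduction to the axioms, the instances of the local axiom schemata in $\mathsf{LAS}_P$, the elements of $\mathsf{TS}$, and the elements of $\mathsf T_P^0$, then one of the following conditions holds: 1. $P\text{ trusts }\langle D,O,\mathsf{sattestor}(\widehat\ell)\rangle$ is in $\mathsf T_P^0$ for some $\widehat\ell\succeq\ell$; or 2. $\mathsf{SATT}(D,O)\in\mathsf{LAS}_P$; or 3. for some $g\in\widehat\Gamma$ and $\widehat\ell\succeq\ell$: (a) $\mathsf{DEL}(g,\mathsf{sattestor}(\widehat\ell))\in\mathsf{LAS}_P$; and (b) $P\text{ trusts }\langle D,O,g\rangle$ is derivable; or 4. $P\text{ trusts }\langle D,O,\mathsf{sattestor}^*(\widehat\ell)\rangle$ is derivable for some $\widehat\ell\succeq\ell$; or 5. for some $(D',O')$ and $\ell'\succeq\ell''\succeq\ell$: (a) $P\text{ trusts }\langle D',O',\mathsf{sattestor}^*(\ell')\rangle$ is derivable; and (b) $P\text{ trusts }(D',O')\text{ says }\langle D,O,\mathsf{sattestor}(\ell'')\rangle$ is derivable.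
   Context: **Labels.** $\widehat\Lambda$ is a set of (sattestor-free) labels with a partial order $\prec$ ($\ell_1\prec\ell_2$: "$\ell_1$ narrows $\ell_2$", "$\ell_2$ broadens $\ell_1$"); $\preceq,\succ,\succeq$ are the derived relations. It contains a distinguished label $\mathsf{bound}$, incomparable to every other label. For every $\ell$ the set $\{\ell':\ell'\succeq\ell\}$ is finite and linearly ordered. $\widehat\Gamma=\widehat\Lambda\cup\{\mathsf{sattestor}(\ell):\ell\in\widehat\Lambda\}\cup\{\mathsf{sattestor}^*(\ell):\ell\in\widehat\Lambda\}$ (formal, distinct expressions). $\ell$'s range over $\widehat\Lambda$, $g$'s over $\widehat\Gamma$. **Language.** $D$ ranges over domain names, $O$ over onion addresses. A principal is an element of a set $\mathcal P$, or $\langle D,O\rangle$, or a pair $(D,O)$. A bound labeled pair is $\langle D,O\rangle$ (synonymous with $\langle D,O,\mathsf{bound}\rangle$) or $\langle D,O,g\rangle$. A says-statement is $(D,O)\text{ says }\pi$, $\pi$ a bound labeled pair. A trust statement is $P\text{ trusts }\chi$, $\chi$ a says-statement or bound labeled pair. Statements are the pairs $\langle D,O\rangle$/$\langle D,O,\mathsf{bound}\rangle$, says-statements, trust statements, and order statements $\ell\preceq\ell'$ (also written $\ell'\succeq\ell$). Formulae are built from statements with $\rightarrow$ and $\land$. **Axioms** (all instances): - A1: $(\ell_1\succeq\ell_2 \land P\text{ trusts }\langle D,O,\ell_2\rangle)\rightarrow P\text{ trusts }\langle D,O,\ell_1\rangle$. - A2: $(\ell_1\succeq\ell_2\succeq\ell_3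 \land P\text{ trusts }\langle D_1,O_1,\mathsf{sattestor}(\ell_1)\rangle \land P\text{ trusts }(D_1,O_1)\text{ says }\langle D_2,O_2,\ell_2\rangle \land P\text{ trusts }(D_2,O_2)\text{ says }\langle D_2,O_2,\ell_3\rangle)\rightarrow P\text{ trusts }\langle D_2,O_2,\ell_2\rangle$. - A3: $(\ell_1\succeq\ell_2\succeq\ell_3 \land P\text{ trusts }\langle D_1,O_1,\mathsf{sattestor}^*(\ell_1)\rangle \land P\text{ trusts }(D_1,O_1)\text{ says }\langle D_2,O_2,\mathsf{sattestor}^*(\ell_2)\rangle \land P\text{ trusts }(D_2,O_2)\text{ says }\langle D_3,O_3,\mathsf{sattestor}(\ell_3)\rangle)\rightarrow P\text{ trusts }\langle D_2,O_2,\mathsf{sattestor}^*(\ell_3)\rangle$. - A4: $(\ell_1\succeq\ell_2\succeq\ell_3 \land P\text{ trusts }\langle D_1,O_1,\mathsf{sattestor}^*(\ell_1)\rangle \land P\text{ trusts }(D_1,O_1)\text{ says }\langle D_2,O_2,\mathsf{sattestor}(\ell_2)\rangle \land P\text{ trusts }(D_2,O_2)\text{ says }\langle D_3,O_3,\ell_3\rangle)\rightarrow P\text{ trusts }\langle D_2,O_2,\mathsf{sattestor}(\ell_3)\rangle$. - A5: $P\text{ trusts }\langle D,O,g\rangle\rightarrow P\text{ trusts }\langle D,O,\mathsf{bound}\rangle$. - A6: $(P\text{ trusts }(D,O)\text{ says }\varphi)\rightarrow (P\text{ trusts }(D,O)\text{ says }\langle D,O,\mathsf{bound}\rangle)$.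 - A7: $P\text{ trusts }\langle D,O,\mathsf{sattestor}^*(\ell)\rangle\rightarrow P\text{ trusts }\langle D,O,\mathsf{sattestor}(\ell)\rangle$. - A8: $P\text{ trusts }(D_1,O_1)\text{ says }\langle D_2,O_2,\mathsf{sattestor}^*(\ell)\rangle\rightarrow P\text{ trusts }(D_1,O_1)\text{ says }\langle D_2,O_2,\mathsf{sattestor}(\ell)\rangle$. - A9: $(\ell_1\succeq\ell_2\land P\text{ trusts }\langle D,O,\mathsf{sattestor}(\ell_1)\rangle)\rightarrow P\text{ trusts }\langle D,O,\mathsf{sattestor}(\ell_2)\rangle$. - A10: $(\ell_1\succeq\ell_2\land P\text{ trusts }\langle D,O,\mathsf{sattestor}^*(\ell_1)\rangle)\rightarrow P\text{ trusts }\langle D,O,\mathsf{sattestor}^*(\ell_2)\rangle$. - A11: $(D,O)\text{ says }\varphi\rightarrow (P\text{ trusts }(D,O)\text{ says }\varphi)$. - A12: (a) $(\varphi\land\psi)\rightarrow\varphi$; (b) $(\varphi\land\psi)\rightarrow(\psi\land\varphi)$; (c) $(\varphi\land(\psi\land\delta))\rightarrow((\varphi\land\psi)\land\delta)$. **Local axiom schemata** for $P$: - $\mathsf{DEL}(g_1,g_2)$: $P\text{ trusts }\langle D,O,g_1\rangle\rightarrow P\text{ trusts }\langle D,O,g_2\rangle$, for the given $g_1,g_2$ and any $D,O$. - $\mathsf{SATT}(D,O)$: $P\text{ trusts }\langle D,O,\mathsf{sattestor}(\ell)\rangle$, for the given $D,O$ and all labels $\ell$. - $\mathsf{SATT}^*(D,O)$: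 $P\text{ trusts }\langle D,O,\mathsf{sattestor}^*(\ell)\rangle$, for the given $D,O$ and all labels $\ell$. **Rules.** Modus ponens (from $\varphi$ and $\varphi\rightarrow\psi$ infer $\psi$) and $\land$-introduction (from $\varphi$ and $\psi$ infer $\varphi\land\psi$). **Setting.** $\mathsf T_P^0$ is a set of trust statements of the form $P\text{ trusts }X$; $\mathsf{LAS}_P$ is a set of instances $\mathsf{DEL}(g_1,g_2)$, $\mathsf{SATT}(D,O)$, $\mathsf{SATT}^*(D,O)$; $\mathsf{TS}$ is a set of says-statements. "Derivable" always means derivable by modus ponens and $\land$-introduction from the axioms, $\mathsf{LAS}_P$, $\mathsf{TS}$ and $\mathsf T_P^0$, with the true facts $\ell\preceq\ell'$ about the label order also available as assumptions. All elements of these sets are conjunction-free, and derivations are assumed not to contain applications of modus ponens to axiom A12(a). *)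

theory Defs
  imports Main
begin

text \<open>
  \<open>l1 < l2\<close> reads ``\<open>l1\<close> narrows \<open>l2\<close>'' (and \<open>l2\<close> broadens \<open>l1\<close>). An instance type of this class
  is the set of sattestor-free labels.
\<close>

class narrowing_order = order +
  fixes bound :: 'a
  assumes bound_incomparable: "l \<noteq> bound \<Longrightarrow> \<not> l \<le> bound \<and> \<not> bound \<le> l"
    and finite_broader: "finite {l'. l \<le> l'}"
    and linear_broader: "l \<le> l1 \<Longrightarrow> l \<le> l2 \<Longrightarrow> l1 \<le> l2 \<or> l2 \<le> l1"

datatype 'l glabel = Lab 'l | Sattestor 'l | SattestorStar 'l

text \<open>The type variable \<open>'p\<close> is the set of basic principals.\<close>

datatype ('p, 'd, 'o) principal = Basic 'p | BoundPrincipal 'd 'o | PairPrincipal 'd 'o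

text \<open>
  The unlabeled pair \<open>\<langle>D,O\<rangle>\<close> is synonymous with \<open>\<langle>D,O,bound\<rangle>\<close>, hence represented
  by \<open>LPair D On (Lab bound)\<close>. An onion address \<open>O\<close> is written \<open>On\<close>, since \<open>O\<close> is the infix
  of relation composition.
\<close>

datatype ('d, 'o, 'l) labeled_pair = LPair 'd 'o "'l glabel"

datatype ('d, 'o, 'l) says_stmt = Says 'd 'o "('d, 'o, 'l) labeled_pair"

datatype ('d, 'o, 'l) trust_object =
    PairObj "('d, 'o, 'l) labeled_pair"
  | SaysObj "('d, 'o, 'l) says_stmt"

datatype ('p, 'd, 'o, 'l) trust_stmt =
  Trusts "('p, 'd, 'o) principal" "('d, 'o, 'l) trust_object"

text \<open>
  Among the bound labeled pairs only those with label \<open>bound\<close> are statements by themselves;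
  \<open>BoundStmt D On\<close> is the statement \<open>\<langle>D,O\<rangle>\<close>. The order statement \<open>OrdStmt l l'\<close>
  says that \<open>l'\<close> is at least as broad as \<open>l\<close>.
\<close>

datatype ('p, 'd, 'o, 'l) statement =
    BoundStmt 'd 'o
  | SaysStmt "('d, 'o, 'l) says_stmt"
  | TrustStmt "('p, 'd, 'o, 'l) trust_stmt"
  | OrdStmt 'l 'l

datatype ('p, 'd, 'o, 'l) formula =
    Atom "('p, 'd, 'o, 'l) statement"
  | Imp "('p, 'd, 'o, 'l) formula" "('p, 'd, 'o, 'l) formula" (infixr "\<^bold>\<rightarrow>" 25)
  | And "('p, 'd, 'o, 'l) formula" "('p, 'd, 'o, 'l) formula" (infixr "\<^bold>\<and>" 35)

abbreviation trusts_pair ::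
    "('p, 'd, 'o) principal \<Rightarrow> 'd \<Rightarrow> 'o \<Rightarrow> 'l glabel \<Rightarrow> ('p, 'd, 'o, 'l) formula"
    ("_ trusts \<langle>_,_,_\<rangle>" [51, 0, 0, 0] 50) where
  "P trusts \<langle>D,On,g\<rangle> \<equiv> Atom (TrustStmt (Trusts P (PairObj (LPair D On g))))"

abbreviation trusts_says ::
    "('p, 'd, 'o) principal \<Rightarrow> 'd \<Rightarrow> 'o \<Rightarrow> 'd \<Rightarrow> 'o \<Rightarrow> 'l glabel \<Rightarrow> ('p, 'd, 'o, 'l) formula"
    ("_ trusts '(_,_') says \<langle>_,_,_\<rangle>" [51, 0, 0, 0, 0, 0] 50) where
  "P trusts (D,On) says \<langle>D',On',g\<rangle> \<equiv>
     Atom (TrustStmt (Trusts P (SaysObj (Says D On (LPair D' On' g)))))"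

abbreviation broader_eq :: "'l \<Rightarrow> 'l \<Rightarrow> ('p, 'd, 'o, 'l) formula" (infix "\<^bold>\<succeq>" 50) where
  "l' \<^bold>\<succeq> l \<equiv> Atom (OrdStmt l l')"

definition A12a_instance :: "('p, 'd, 'o, 'l) formula \<Rightarrow> bool" where
  "A12a_instance \<chi> \<longleftrightarrow> (\<exists>\<phi> \<psi>. \<chi> = (\<phi> \<^bold>\<and> \<psi> \<^bold>\<rightarrow> \<phi>))"

text \<open>
  Conjunctions of more than two formulae associate to the right, and a chain of two order
  statements is their conjunction; by A12b and A12c the bracketing does not matter.
\<close>

inductive axiom_instance :: "('p, 'd, 'o, 'l :: narrowing_order) formula \<Rightarrow> bool" where
  A1: "axiom_instance
    (l1 \<^bold>\<succeq> l2 \<^bold>\<and> P trusts \<langle>D,On,Lab l2\<rangle> \<^bold>\<rightarrow> P trusts \<langle>D,On,Lab l1\<rangle>)"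
| A2: "axiom_instance
    ((l1 \<^bold>\<succeq> l2 \<^bold>\<and> l2 \<^bold>\<succeq> l3) \<^bold>\<and> P trusts \<langle>D1,O1,Sattestor l1\<rangle>
       \<^bold>\<and> P trusts (D1,O1) says \<langle>D2,O2,Lab l2\<rangle>
       \<^bold>\<and> P trusts (D2,O2) says \<langle>D2,O2,Lab l3\<rangle>
     \<^bold>\<rightarrow> P trusts \<langle>D2,O2,Lab l2\<rangle>)"
| A3: "axiom_instance
    ((l1 \<^bold>\<succeq> l2 \<^bold>\<and> l2 \<^bold>\<succeq> l3) \<^bold>\<and> P trusts \<langle>D1,O1,SattestorStar l1\<rangle>
       \<^bold>\<and> P trusts (D1,O1) says \<langle>D2,O2,SattestorStar l2\<rangle>
       \<^bold>\<and> P trusts (D2,O2) says \<langle>D3,O3,Sattestor l3\<rangle>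
     \<^bold>\<rightarrow> P trusts \<langle>D2,O2,SattestorStar l3\<rangle>)"
| A4: "axiom_instance
    ((l1 \<^bold>\<succeq> l2 \<^bold>\<and> l2 \<^bold>\<succeq> l3) \<^bold>\<and> P trusts \<langle>D1,O1,SattestorStar l1\<rangle>
       \<^bold>\<and> P trusts (D1,O1) says \<langle>D2,O2,Sattestor l2\<rangle>
       \<^bold>\<and> P trusts (D2,O2) says \<langle>D3,O3,Lab l3\<rangle>
     \<^bold>\<rightarrow> P trusts \<langle>D2,O2,Sattestor l3\<rangle>)"
| A5: "axiom_instance (P trusts \<langle>D,On,g\<rangle> \<^bold>\<rightarrow> P trusts \<langle>D,On,Lab bound\<rangle>)"
| A6: "axiom_instance
    (P trusts (D,On) says \<langle>D',On',g\<rangle> \<^bold>\<rightarrow> P trusts (D,On) says \<langle>D,On,Lab bound\<rangle>)"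
| A7: "axiom_instance
    (P trusts \<langle>D,On,SattestorStar l\<rangle> \<^bold>\<rightarrow> P trusts \<langle>D,On,Sattestor l\<rangle>)"
| A8: "axiom_instance
    (P trusts (D1,O1) says \<langle>D2,O2,SattestorStar l\<rangle>
     \<^bold>\<rightarrow> P trusts (D1,O1) says \<langle>D2,O2,Sattestor l\<rangle>)"
| A9: "axiom_instance
    (l1 \<^bold>\<succeq> l2 \<^bold>\<and> P trusts \<langle>D,On,Sattestor l1\<rangle> \<^bold>\<rightarrow> P trusts \<langle>D,On,Sattestor l2\<rangle>)"
| A10: "axiom_instance
    (l1 \<^bold>\<succeq> l2 \<^bold>\<and> P trusts \<langle>D,On,SattestorStar l1\<rangle>
     \<^bold>\<rightarrow> P trusts \<langle>D,On,SattestorStar l2\<rangle>)"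
| A11: "axiom_instance
    (Atom (SaysStmt (Says D On (LPair D' On' g))) \<^bold>\<rightarrow> P trusts (D,On) says \<langle>D',On',g\<rangle>)"
| A12a: "A12a_instance \<chi> \<Longrightarrow> axiom_instance \<chi>"
| A12b: "axiom_instance (\<phi> \<^bold>\<and> \<psi> \<^bold>\<rightarrow> \<psi> \<^bold>\<and> \<phi>)"
| A12c: "axiom_instance (\<phi> \<^bold>\<and> (\<psi> \<^bold>\<and> \<delta>) \<^bold>\<rightarrow> (\<phi> \<^bold>\<and> \<psi>) \<^bold>\<and> \<delta>)"

datatype ('d, 'o, 'l) local_schema =
    DEL "'l glabel" "'l glabel"
  | SATT 'd 'o
  | SATTStar 'd 'o

fun schema_instances ::
    "('p, 'd, 'o) principal \<Rightarrow> ('d, 'o, 'l) local_schema \<Rightarrow> ('p, 'd, 'o, 'l) formula set" where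
  "schema_instances P (DEL g1 g2) =
     {(P trusts \<langle>D,On,g1\<rangle> \<^bold>\<rightarrow> P trusts \<langle>D,On,g2\<rangle>) | D On. True}"
| "schema_instances P (SATT D On) = {P trusts \<langle>D,On,Sattestor l\<rangle> | l. True}"
| "schema_instances P (SATTStar D On) = {P trusts \<langle>D,On,SattestorStar l\<rangle> | l. True}"

text \<open>
  Derivations do not apply modus ponens to an instance of A12a; hence the side condition of
  \<open>modus_ponens\<close>. The facts \<open>order_fact\<close> make the label order itself available.
\<close>

inductive derivable ::
    "('p, 'd, 'o) principal \<Rightarrow> ('d, 'o, 'l :: narrowing_order) local_schema set
      \<Rightarrow> ('d, 'o, 'l) says_stmt set \<Rightarrow> ('p, 'd, 'o, 'l) trust_stmt set
      \<Rightarrow> ('p, 'd, 'o, 'l) formula \<Rightarrow> bool"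
  for P LAS TS T0 where
  axiom: "axiom_instance \<phi> \<Longrightarrow> derivable P LAS TS T0 \<phi>"
| order_fact: "l \<le> l' \<Longrightarrow> derivable P LAS TS T0 (l' \<^bold>\<succeq> l)"
| local_axiom: "s \<in> LAS \<Longrightarrow> \<phi> \<in> schema_instances P s \<Longrightarrow> derivable P LAS TS T0 \<phi>"
| says_fact: "s \<in> TS \<Longrightarrow> derivable P LAS TS T0 (Atom (SaysStmt s))"
| initial_trust: "t \<in> T0 \<Longrightarrow> derivable P LAS TS T0 (Atom (TrustStmt t))"
| modus_ponens: "derivable P LAS TS T0 \<phi> \<Longrightarrow> derivable P LAS TS T0 (\<phi> \<^bold>\<rightarrow> \<psi>)
    \<Longrightarrow> \<not> A12a_instance (\<phi> \<^bold>\<rightarrow> \<psi>) \<Longrightarrow> derivable P LAS TS T0 \<psi>"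
| and_intro: "derivable P LAS TS T0 \<phi> \<Longrightarrow> derivable P LAS TS T0 \<psi>
    \<Longrightarrow> derivable P LAS TS T0 (\<phi> \<^bold>\<and> \<psi>)"

end

theory Submission
  imports Defs
begin

text \<open>
  Modus ponens is never applied to A12a, and no other axiom has an implication as its conclusion.
  Hence every derivable implication is an axiom or an instance of DEL, and every conjunct of a
  derivable formula is derivable. An induction over derivations then only has to look at the
  axioms that conclude \<open>P trusts \<langle>D,On,Sattestor l\<rangle>\<close>: A7, A4 and DEL give conditions 4, 5 and 3,
  while A9 passes to a broader label, for which the conditions are already known.
\<close>

text \<open>Flattening forgets order and bracketing, which is all that A12b and A12c change.
  Implications stay whole: their two sides need not be derivable.\<close>

fun conjuncts :: "('p, 'd, 'o, 'l) formula \<Rightarrow> ('p, 'd, 'o, 'l) formula set" where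
  "conjuncts (\<phi> \<^bold>\<and> \<psi>) = conjuncts \<phi> \<union> conjuncts \<psi>"
| "conjuncts (Atom s) = {Atom s}"
| "conjuncts (\<phi> \<^bold>\<rightarrow> \<psi>) = {\<phi> \<^bold>\<rightarrow> \<psi>}"

lemma axiom_instance_is_Imp: "axiom_instance \<phi> \<Longrightarrow> \<exists>\<alpha> \<beta>. \<phi> = (\<alpha> \<^bold>\<rightarrow> \<beta>)"
  by (cases rule: axiom_instance.cases) (auto simp: A12a_instance_def)

text \<open>Only A12a leaves the shape of its conclusion open; every other schema concludes an atom
  or a conjunction.\<close>

lemma axiom_instance_conclusion_not_Imp:
  "axiom_instance (\<phi> \<^bold>\<rightarrow> (\<alpha> \<^bold>\<rightarrow> \<beta>)) \<Longrightarrow> A12a_instance (\<phi> \<^bold>\<rightarrow> (\<alpha> \<^bold>\<rightarrow> \<beta>))"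
  by (cases rule: axiom_instance.cases) auto

text \<open>This leaves A12b and A12c, which merely rearrange the conjuncts.\<close>

lemma axiom_instance_conclusion_And:
  assumes "axiom_instance (\<phi> \<^bold>\<rightarrow> (\<alpha> \<^bold>\<and> \<beta>))" and "\<not> A12a_instance (\<phi> \<^bold>\<rightarrow> (\<alpha> \<^bold>\<and> \<beta>))"
  shows "conjuncts (\<alpha> \<^bold>\<and> \<beta>) = conjuncts \<phi>"
  using assms by (cases rule: axiom_instance.cases) auto

lemma schema_instance_cases:
  assumes "\<phi> \<in> schema_instances P s"
  obtains (DEL) g1 g2 D On where "s = DEL g1 g2"
      "\<phi> = (P trusts \<langle>D,On,g1\<rangle> \<^bold>\<rightarrow> P trusts \<langle>D,On,g2\<rangle>)"
    | (SATT) D On l where "s = SATT D On" "\<phi> = (P trusts \<langle>D,On,Sattestor l\<rangle>)"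
    | (SATTStar) D On l where "s = SATTStar D On" "\<phi> = (P trusts \<langle>D,On,SattestorStar l\<rangle>)"
  using assms by (cases s) auto

lemma derivable_Imp_cases:
  assumes "derivable P LAS TS T0 (\<phi> \<^bold>\<rightarrow> \<psi>)"
  obtains (axiom) "axiom_instance (\<phi> \<^bold>\<rightarrow> \<psi>)"
    | (DEL) g1 g2 D On where "DEL g1 g2 \<in> LAS"
      "\<phi> = (P trusts \<langle>D,On,g1\<rangle>)" "\<psi> = (P trusts \<langle>D,On,g2\<rangle>)"
proof -
  have "axiom_instance (\<phi> \<^bold>\<rightarrow> \<psi>) \<or> (\<exists>g1 g2 D On. DEL g1 g2 \<in> LAS
      \<and> \<phi> = (P trusts \<langle>D,On,g1\<rangle>) \<and> \<psi> = (P trusts \<langle>D,On,g2\<rangle>))"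
    using assms
  proof (induction "\<phi> \<^bold>\<rightarrow> \<psi>" arbitrary: \<phi> \<psi>)
    case (local_axiom s)
    from local_axiom(2) show ?case
      using local_axiom(1) by (cases rule: schema_instance_cases) auto
  next
    \<comment> \<open>By induction the major premise is an axiom, hence A12a, which is excluded, or
      comes from \<open>DEL\<close>, whose conclusion is an atom.\<close>
    case modus_ponens
    then show ?case
      using axiom_instance_conclusion_not_Imp by blast
  qed auto
  then show thesis
    using that by blast
qed

text \<open>Stands in for the barred A12a: a conjunction arises only from \<open>and_intro\<close>
  or by rearranging another one, so its conjuncts were derived before it.\<close>

lemma derivable_conjunct:
  "derivable P LAS TS T0 \<phi> \<Longrightarrow> \<chi> \<in> conjuncts \<phi> \<Longrightarrow> derivable P LAS TS T0 \<chi>"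
proof (induction rule: derivable.induct)
  case (axiom \<phi>)
  then show ?case
    using axiom_instance_is_Imp derivable.axiom by fastforce
next
  case (local_axiom s \<phi>)
  from local_axiom(2) have "conjuncts \<phi> = {\<phi>}"
    by (cases rule: schema_instance_cases) auto
  then show ?case
    using local_axiom derivable.local_axiom by fastforce
next
  case (modus_ponens \<phi> \<psi>)
  have \<psi>: "derivable P LAS TS T0 \<psi>"
    using modus_ponens.hyps by (rule derivable.modus_ponens)
  show ?case
  proof (cases \<psi>)
    case (And \<alpha> \<beta>)
    from modus_ponens.hyps(2) have "conjuncts \<psi> = conjuncts \<phi>"
      using modus_ponens.hyps(3) axiom_instance_conclusion_And
      by (cases rule: derivable_Imp_cases) (auto simp: And)
    then show ?thesis
      using modus_ponens by simp
  qed (use modus_ponens.prems \<psi> in auto)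
qed (auto intro: derivable.intros)

text \<open>Order statements enter only through \<open>order_fact\<close>. This turns the order
  premises of A4 and A9 into true inequalities.\<close>

lemma derivable_order_sound:
  assumes "derivable P LAS TS T0 \<phi>" and "(l' \<^bold>\<succeq> l) \<in> conjuncts \<phi>"
  shows "l \<le> l'"
  using assms
proof (induction rule: derivable.induct)
  case (axiom \<phi>)
  then show ?case
    using axiom_instance_is_Imp by fastforce
next
  case (local_axiom s \<phi>)
  from local_axiom(2) show ?case
    using local_axiom(3) by (cases rule: schema_instance_cases) auto
next
  case (modus_ponens \<phi> \<psi>)
  from modus_ponens.hyps(2) show ?case
  proof (cases rule: derivable_Imp_cases)
    case axiom
    then show ?thesis
      using modus_ponens by (cases rule: axiom_instance.cases) auto
  qed (use modus_ponens.prems in auto)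
qed auto

definition sattestor_source where
  "sattestor_source P LAS TS T0 D On l \<longleftrightarrow>
     (\<exists>lh. l \<le> lh \<and> Trusts P (PairObj (LPair D On (Sattestor lh))) \<in> T0)
     \<or> SATT D On \<in> LAS
     \<or> (\<exists>g lh. l \<le> lh \<and> DEL g (Sattestor lh) \<in> LAS
          \<and> derivable P LAS TS T0 (P trusts \<langle>D,On,g\<rangle>))
     \<or> (\<exists>lh. l \<le> lh \<and> derivable P LAS TS T0 (P trusts \<langle>D,On,SattestorStar lh\<rangle>))
     \<or> (\<exists>D' On' l' l''. l'' \<le> l' \<and> l \<le> l''
          \<and> derivable P LAS TS T0 (P trusts \<langle>D',On',SattestorStar l'\<rangle>)
          \<and> derivable P LAS TS T0 (P trusts (D',On') says \<langle>D,On,Sattestor l''\<rangle>))"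

text \<open>Each alternative that mentions \<open>l\<close> only bounds it from above, so
  transitivity suffices.\<close>

lemma sattestor_source_broader:
  "l \<le> l1 \<Longrightarrow> sattestor_source P LAS TS T0 D On l1 \<Longrightarrow> sattestor_source P LAS TS T0 D On l"
  unfolding sattestor_source_def by (blast intro: order_trans)

text \<open>Stated for conjuncts because A12b and A12c, and the premise of A9, lead the induction
  through conjunctions; \<open>l\<close> varies because A9 changes the label.\<close>

lemma derivable_sattestor_conjunct:
  assumes "derivable P LAS TS T0 \<phi>" and "(P trusts \<langle>D,On,Sattestor l\<rangle>) \<in> conjuncts \<phi>"
  shows "sattestor_source P LAS TS T0 D On l"
  using assms
proof (induction arbitrary: l rule: derivable.induct)
  case (axiom \<phi>)
  then show ?case
    using axiom_instance_is_Imp by fastforce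
next
  case (local_axiom s \<phi>)
  from local_axiom(2) show ?case
    using local_axiom(1,3)
    by (cases rule: schema_instance_cases) (auto simp: sattestor_source_def)
next
  case (initial_trust t)
  then show ?case
    by (auto simp: sattestor_source_def)
next
  case (modus_ponens \<phi> \<psi>)
  note der = derivable_conjunct[OF modus_ponens.hyps(1)]
    and ord = derivable_order_sound[OF modus_ponens.hyps(1)]
  from modus_ponens.hyps(2) show ?case
  proof (cases rule: derivable_Imp_cases)
    \<comment> \<open>Condition 3, with \<open>g1\<close> as \<open>g\<close> and \<open>l\<close>
      itself as \<open>lh\<close>.\<close>
    case (DEL g1 g2 D' On')
    then show ?thesis
      using modus_ponens.prems modus_ponens.hyps(1) by (auto simp: sattestor_source_def)
  next
    case axiom
    then show ?thesis
    proof (cases rule: axiom_instance.cases)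
      case (A4 l1 l2 l3 P' D1 O1 D2 O2 D3 O3)
      then have "P' = P" "D2 = D" "O2 = On" "l3 = l"
        using modus_ponens.prems by auto
      \<comment> \<open>The attesting pair \<open>D1\<close>, \<open>O1\<close> and the labels
        \<open>l1\<close>, \<open>l2\<close> of A4 are the witnesses for condition 5.\<close>
      then have "l2 \<le> l1 \<and> l \<le> l2
          \<and> derivable P LAS TS T0 (P trusts \<langle>D1,O1,SattestorStar l1\<rangle>)
          \<and> derivable P LAS TS T0 (P trusts (D1,O1) says \<langle>D,On,Sattestor l2\<rangle>)"
        using A4 by (auto intro!: der ord)
      then show ?thesis
        unfolding sattestor_source_def by blast
    next
      \<comment> \<open>Condition 4, again with \<open>l\<close> itself as
        \<open>lh\<close>.\<close>
      case (A7 P' D' On' l')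
      then show ?thesis
        using modus_ponens.prems modus_ponens.hyps(1) by (auto simp: sattestor_source_def)
    next
      case (A9 l1 l2 P' D' On')
      then have *: "P' = P" "D' = D" "On' = On" "l2 = l"
        using modus_ponens.prems by auto
      have "l \<le> l1"
        using A9 * by (auto intro!: ord)
      \<comment> \<open>The induction hypothesis for the premise of A9 is used at the broader label
        \<open>l1\<close>.\<close>
      moreover have "(P trusts \<langle>D,On,Sattestor l1\<rangle>) \<in> conjuncts \<phi>"
        using A9 * by simp
      ultimately show ?thesis
        by (rule sattestor_source_broader[OF _ modus_ponens.IH(1)])
    next
      case A12a
      then show ?thesis
        using modus_ponens.hyps(3) by blast
    next
      case (A12b \<alpha> \<beta>)
      then show ?thesis
        using modus_ponens.IH(1) modus_ponens.prems by auto
    next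
      case (A12c \<alpha> \<beta> \<gamma>)
      then show ?thesis
        using modus_ponens.IH(1) modus_ponens.prems by auto
    qed (use modus_ponens.prems in auto)
  qed
next
  case (and_intro \<phi> \<psi>)
  then show ?case
    by auto
qed auto

theorem mainTheorem5:
  fixes P :: "('p, 'd, 'o) principal"
    and LAS :: "('d, 'o, 'l :: narrowing_order) local_schema set"
    and TS :: "('d, 'o, 'l) says_stmt set"
    and T0 :: "('p, 'd, 'o, 'l) trust_stmt set"
    and D :: 'd and On :: 'o and l :: 'l
  assumes "\<And>t. t \<in> T0 \<Longrightarrow> \<exists>X. t = Trusts P X"
    and "derivable P LAS TS T0 (P trusts \<langle>D,On,Sattestor l\<rangle>)"
  shows
    "(\<exists>lh. l \<le> lh \<and> Trusts P (PairObj (LPair D On (Sattestor lh))) \<in> T0)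
     \<or> SATT D On \<in> LAS
     \<or> (\<exists>g lh. l \<le> lh \<and> DEL g (Sattestor lh) \<in> LAS
          \<and> derivable P LAS TS T0 (P trusts \<langle>D,On,g\<rangle>))
     \<or> (\<exists>lh. l \<le> lh \<and> derivable P LAS TS T0 (P trusts \<langle>D,On,SattestorStar lh\<rangle>))
     \<or> (\<exists>D' On' l' l''. l'' \<le> l' \<and> l \<le> l''
          \<and> derivable P LAS TS T0 (P trusts \<langle>D',On',SattestorStar l'\<rangle>)
          \<and> derivable P LAS TS T0 (P trusts (D',On') says \<langle>D,On,Sattestor l''\<rangle>))"
  using derivable_sattestor_conjunct[OF assms(2)] by (simp add: sattestor_source_def)

end
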